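(* Let $\{x_i\}_{i=1}^m$ be a unit-norm frame for $\mathbb{R}^n$. If $\{x_i\}_{i=1}^m$ is piecewise scalable with constants $\{a_i,b_i\}_{i=1}^m$, then $$n\le\sum_{i=1}^m\max(a_i^2,b_i^2).$$
   Context: A finite family $\{x_i\}_{i=1}^m$ in $\mathbb{R}^n$ is a frame for $\mathbb{R}^n$ if there are constants $0<A\le B<\infty$ with $A\|x\|^2\le\sum_{i=1}^m|\langle x,x_i\rangle|^2\le B\|x\|^2$ for all $x\in\mathbb{R}^n$; it is unit-norm if all $\|x_i\|=1$, and Parseval if $\sum_{i=1}^m|\langle x,x_i\rangle|^2=\|x\|^2$ for all $x\in\mathbb{R}^n$. An orthogonal projection is a linear map $P$ with $P\circ P=P$ and $P^*=P$. A frame $\{x_i\}_{i=1}^m$ for $\mathbb{R}^n$ is piecewise scalable with real constants $\{a_i,b_i\}_{i=1}^m$ if there exists an orthogonal projection $P:\mathbb{R}^n\to\mathbb{R}^n$ such that $\{a_iPx_i+b_i(I-P)x_i\}_{i=1}^m$ is a Parseval frame for $\mathbb{R}^n$. *)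

theory Defs
  imports "HOL-Analysis.Analysis"
begin

text \<open>A family \<open>x\<^sub>1, \<dots>, x\<^sub>m\<close> in $R^n$ is a function on the naturals of which only
  the values at the indices in \<open>{1..m}\<close> matter; $n$ is \<open>CARD('n)\<close>.\<close>

definition is_frame :: "nat \<Rightarrow> (nat \<Rightarrow> real ^ 'n) \<Rightarrow> bool" where
  "is_frame m x \<longleftrightarrow>
     (\<exists>A B. 0 < A \<and> A \<le> B \<and>
       (\<forall>v. A * (norm v)\<^sup>2 \<le> (\<Sum>i=1..m. \<bar>v \<bullet> x i\<bar>\<^sup>2) \<and>
            (\<Sum>i=1..m. \<bar>v \<bullet> x i\<bar>\<^sup>2) \<le> B * (norm v)\<^sup>2))"

definition unit_norm :: "nat \<Rightarrow> (nat \<Rightarrow> real ^ 'n) \<Rightarrow> bool" where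
  "unit_norm m x \<longleftrightarrow> (\<forall>i\<in>{1..m}. norm (x i) = 1)"

definition parseval_frame :: "nat \<Rightarrow> (nat \<Rightarrow> real ^ 'n) \<Rightarrow> bool" where
  "parseval_frame m x \<longleftrightarrow>
     is_frame m x \<and> (\<forall>v. (\<Sum>i=1..m. \<bar>v \<bullet> x i\<bar>\<^sup>2) = (norm v)\<^sup>2)"

definition orthogonal_projection :: "(real ^ 'n \<Rightarrow> real ^ 'n) \<Rightarrow> bool" where
  "orthogonal_projection P \<longleftrightarrow> linear P \<and> P \<circ> P = P \<and> adjoint P = P"

definition piecewise_scalable ::
    "nat \<Rightarrow> (nat \<Rightarrow> real ^ 'n) \<Rightarrow> (nat \<Rightarrow> real) \<Rightarrow> (nat \<Rightarrow> real) \<Rightarrow> bool" where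
  "piecewise_scalable m x a b \<longleftrightarrow>
     is_frame m x \<and>
     (\<exists>P. orthogonal_projection P \<and>
       parseval_frame m (\<lambda>i. a i *\<^sub>R P (x i) + b i *\<^sub>R (x i - P (x i))))"

end

theory Submission
  imports Defs
begin

text \<open>Summing the Parseval identity over an orthonormal basis shows that the squared norms of a
  Parseval frame add up to the dimension. By Pythagoras, the squared norm of
  \<open>a\<^sub>i P x\<^sub>i + b\<^sub>i (I - P) x\<^sub>i\<close> is a convex combination of \<open>a\<^sub>i\<^sup>2\<close> and \<open>b\<^sub>i\<^sup>2\<close>,
  with weights \<open>\<parallel>P x\<^sub>i\<parallel>\<^sup>2\<close> and \<open>\<parallel>(I - P) x\<^sub>i\<parallel>\<^sup>2\<close>.\<close>

lemma parseval_frame_sum_norm_sq: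
  fixes y :: "nat \<Rightarrow> real ^ 'n"
  assumes "parseval_frame m y"
  shows "(\<Sum>i=1..m. (norm (y i))\<^sup>2) = real CARD('n)"
proof -
  \<comment> \<open>Expanding each \<open>y i\<close> in \<open>Basis\<close> and swapping the sums
    leaves, for each \<open>e\<close>, the Parseval sum at \<open>e\<close>, which is 1.\<close>
  have "(norm (y i))\<^sup>2 = (\<Sum>e\<in>Basis. \<bar>e \<bullet> y i\<bar>\<^sup>2)" for i
    by (simp only: power2_norm_eq_inner power2_abs)
      (subst euclidean_inner, simp add: power2_eq_square inner_commute)
  then have "(\<Sum>i=1..m. (norm (y i))\<^sup>2) = (\<Sum>e\<in>Basis. \<Sum>i=1..m. \<bar>e \<bullet> y i\<bar>\<^sup>2)"
    by (simp only:) (rule sum.swap)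
  also have "\<dots> = (\<Sum>e\<in>(Basis :: (real ^ 'n) set). (norm e)\<^sup>2)"
    using assms by (simp only: parseval_frame_def)
  also have "\<dots> = real CARD('n)"
    by simp
  finally show ?thesis .
qed

text \<open>Self-adjointness moves one \<open>P\<close> across \<open>P v \<bullet> P v\<close> and
  idempotence absorbs it, leaving \<open>v \<bullet> P v\<close>.\<close>

lemma orthogonal_projection_inner_diff:
  assumes "orthogonal_projection P"
  shows "P v \<bullet> (v - P v) = 0"
proof -
  have P: "linear P" "adjoint P = P" and idem: "P (P v) = P v"
    using assms by (auto simp: orthogonal_projection_def fun_eq_iff)
  have "P v \<bullet> P v = v \<bullet> P (P v)"
    using adjoint_works[OF P(1), of v "P v"] P(2) by simp
  then show ?thesis
    by (simp add: idem inner_diff_right inner_commute)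
qed

lemma norm_sq_piecewise_scaling_le:
  assumes "orthogonal_projection P"
  shows "(norm (a *\<^sub>R P v + b *\<^sub>R (v - P v)))\<^sup>2 \<le> max (a\<^sup>2) (b\<^sup>2) * (norm v)\<^sup>2"
proof -
  have orth: "orthogonal (P v) (v - P v)"
    using orthogonal_projection_inner_diff[OF assms] by (simp add: orthogonal_def)
  have "(norm (a *\<^sub>R P v + b *\<^sub>R (v - P v)))\<^sup>2
      = a\<^sup>2 * (norm (P v))\<^sup>2 + b\<^sup>2 * (norm (v - P v))\<^sup>2"
    using orth by (subst norm_add_Pythagorean) (simp_all add: orthogonal_def power_mult_distrib)
  \<comment> \<open>With the same coefficient on both parts, Pythagoras applies a second time,
    backwards, and reassembles \<open>v\<close>.\<close>
  also have "\<dots> \<le> max (a\<^sup>2) (b\<^sup>2) * (norm (P v))\<^sup>2 + max (a\<^sup>2) (b\<^sup>2) * (norm (v - P v))\<^sup>2"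
    by (intro add_mono mult_right_mono) auto
  also have "\<dots> = max (a\<^sup>2) (b\<^sup>2) * (norm v)\<^sup>2"
    using norm_add_Pythagorean[OF orth] by (simp add: distrib_left)
  finally show ?thesis .
qed

theorem proposition5p2:
  fixes x :: "nat \<Rightarrow> real ^ 'n" and m :: nat and a b :: "nat \<Rightarrow> real"
  assumes "is_frame m x" and "unit_norm m x"
    and "piecewise_scalable m x a b"
  shows "real CARD('n) \<le> (\<Sum>i=1..m. max ((a i)\<^sup>2) ((b i)\<^sup>2))"
proof -
  obtain P where P: "orthogonal_projection P"
    and parseval: "parseval_frame m (\<lambda>i. a i *\<^sub>R P (x i) + b i *\<^sub>R (x i - P (x i)))"
    using assms(3) unfolding piecewise_scalable_def by blast
  have "real CARD('n) = (\<Sum>i=1..m. (norm (a i *\<^sub>R P (x i) + b i *\<^sub>R (x i - P (x i))))\<^sup>2)"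
    using parseval_frame_sum_norm_sq[OF parseval] by simp
  also have "\<dots> \<le> (\<Sum>i=1..m. max ((a i)\<^sup>2) ((b i)\<^sup>2))"
  proof (rule sum_mono)
    fix i assume "i \<in> {1..m}"
    \<comment> \<open>Unit norm turns the factor \<open>(norm (x i))\<^sup>2\<close> of the termwise
      bound into 1.\<close>
    then have "norm (x i) = 1"
      using assms(2) by (simp add: unit_norm_def)
    then show "(norm (a i *\<^sub>R P (x i) + b i *\<^sub>R (x i - P (x i))))\<^sup>2 \<le> max ((a i)\<^sup>2) ((b i)\<^sup>2)"
      using norm_sq_piecewise_scaling_le[OF P, of "a i" "x i" "b i"] by simp
  qed
  finally show ?thesis .
qed

end
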